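(* Heap isomorphism is a sound equivalence relation on singly linked heaps over $P$. That is, for all singly linked heaps $H, H'$ over $P$ with $H \simeq H'$, all pointer variables $x, y \in P$ and every transformer $\tau$ (any of $\mathit{new}(\cdot,x)$, $\mathit{assign}(\cdot,x,y)$, $\mathit{lookup}(\cdot,x,y)$, $\mathit{update}(\cdot,x,y)$ for any choice of pointer arguments): $\mathit{pathLength}(H,x,y)=\mathit{pathLength}(H',x,y)$, $\mathit{circular}(H,x)=\mathit{circular}(H',x)$, and $\tau(H)\simeq\tau(H')$.
   Context: Fix a finite set $P$ of pointer variables containing a distinguished variable $\mathbf{null}$. A heap over $P$ is a pair $H=\langle L,G\rangle$ where $G$ is a finite directed graph with vertex set $V(G)$ and edge set $E(G)$, and $L:P\to V(G)$ is a labelling function. $H$ is a singly linked heap iff every vertex $v$ either has outdegree $1$ and $v\neq L(\mathbf{null})$, or has outdegree $0$ and $v=L(\mathbf{null})$. For $v\neq L(\mathbf{null})$, $\mathrm{succ}(v)$ denotes the unique vertex with $(v,\mathrm{succ}(v))\in E(G)$. Write $u\xrightarrow{n}v$ if $v$ is reached from $u$ by following exactly $n$ edges ($u\xrightarrow{0}u$). Observations: $\mathit{pathLength}(H,x,y)=\min(\{n\mid L(x)\xrightarrow{n}L(y)\}\cup\{\infty\})$; $\mathit{circular}(H,x)$ holds iff there is a vertex $v$ with $L(x)\xrightarrow{n}v$ and $v\xrightarrow{m}L(x)$ for some $n,m>0$. Transformers (each changes only the listed components): $\mathit{new}(H,x)$ adds a fresh vertex $q$, adds the edge $(q,L(\mathbf{null}))$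 and sets $L[x\mapsto q]$; $\mathit{assign}(H,x,y)$ sets $L[x\mapsto L(y)]$; $\mathit{lookup}(H,x,y)$ sets $L[x\mapsto \mathrm{succ}(L(y))]$; $\mathit{update}(H,x,y)$ replaces the edge $(L(x),\mathrm{succ}(L(x)))$ by $(L(x),L(y))$ (lookup and update are applied only where the needed successor exists). The reachable sub-heap $H|_P$ is $H$ restricted to vertices reachable (by $\ge 0$ edges) from some $L(p)$, $p\in P$. Two heaps $H=\langle L,G\rangle$, $H'=\langle L',G'\rangle$ are isomorphic, $H\simeq H'$, iff there is a graph isomorphism $f:G|_P\to G'|_P$ between the reachable sub-heaps with $f(L(p))=L'(p)$ for all $p\in P$. *)

theory Defs
  imports
    "Graph_Theory.Graph_Theory"
    "HOL-Library.Extended_Nat"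
    "HOL-Library.Infinite_Typeclass"
begin

text \<open>The finite set of pointer variables is the type \<open>'p :: finite\<close>, and the distinguished
  variable is a parameter \<open>null :: 'p\<close>. Vertices are drawn from a type \<open>'v\<close>.\<close>

record ('p, 'v) heap =
  lab :: "'p \<Rightarrow> 'v"
  gr :: "'v pair_pre_digraph"

definition is_heap :: "('p, 'v) heap \<Rightarrow> bool" where
  "is_heap H \<longleftrightarrow> pair_fin_digraph (gr H) \<and> range (lab H) \<subseteq> pverts (gr H)"

definition singly_linked :: "'p \<Rightarrow> ('p, 'v) heap \<Rightarrow> bool" where
  "singly_linked null H \<longleftrightarrow> is_heap H \<and>
     (\<forall>v \<in> pverts (gr H).
        (out_degree (with_proj (gr H)) v = 1 \<and> v \<noteq> lab H null) \<or>
        (out_degree (with_proj (gr H)) v = 0 \<and> v = lab H null))"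

definition succ :: "('p, 'v) heap \<Rightarrow> 'v \<Rightarrow> 'v" where
  "succ H v = (THE w. (v, w) \<in> parcs (gr H))"

definition steps :: "('p, 'v) heap \<Rightarrow> nat \<Rightarrow> 'v \<Rightarrow> 'v \<Rightarrow> bool" where
  "steps H n u v \<longleftrightarrow> (u, v) \<in> parcs (gr H) ^^ n"

text \<open>On \<open>enat\<close>, a well-order, the infimum of a nonempty set is its minimum.\<close>

definition path_length :: "('p, 'v) heap \<Rightarrow> 'p \<Rightarrow> 'p \<Rightarrow> enat" where
  "path_length H x y = Inf ({enat n | n. steps H n (lab H x) (lab H y)} \<union> {\<infinity>})"

definition circular :: "('p, 'v) heap \<Rightarrow> 'p \<Rightarrow> bool" where
  "circular H x \<longleftrightarrow> (\<exists>v \<in> pverts (gr H). \<exists>n > 0. \<exists>m > 0.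
     steps H n (lab H x) v \<and> steps H m v (lab H x))"

definition heap_new :: "'p \<Rightarrow> 'v \<Rightarrow> ('p, 'v) heap \<Rightarrow> 'p \<Rightarrow> ('p, 'v) heap" where
  "heap_new null q H x =
     \<lparr>lab = (lab H)(x := q),
      gr = \<lparr>pverts = insert q (pverts (gr H)),
            parcs = insert (q, lab H null) (parcs (gr H))\<rparr>\<rparr>"

definition heap_assign :: "('p, 'v) heap \<Rightarrow> 'p \<Rightarrow> 'p \<Rightarrow> ('p, 'v) heap" where
  "heap_assign H x y = H\<lparr>lab := (lab H)(x := lab H y)\<rparr>"

definition heap_lookup :: "('p, 'v) heap \<Rightarrow> 'p \<Rightarrow> 'p \<Rightarrow> ('p, 'v) heap" where
  "heap_lookup H x y = H\<lparr>lab := (lab H)(x := succ H (lab H y))\<rparr>"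

definition heap_update :: "('p, 'v) heap \<Rightarrow> 'p \<Rightarrow> 'p \<Rightarrow> ('p, 'v) heap" where
  "heap_update H x y =
     H\<lparr>gr := (gr H)\<lparr>parcs :=
        insert (lab H x, lab H y) (parcs (gr H) - {(lab H x, succ H (lab H x))})\<rparr>\<rparr>"

datatype 'p transformer = New 'p | Assign 'p 'p | Lookup 'p 'p | Update 'p 'p

text \<open>The possible values of a transformer at a heap: one for each choice of the fresh vertex
  in the case of \<open>New\<close>, and none where a needed successor does not exist.\<close>

fun results :: "'p \<Rightarrow> 'p transformer \<Rightarrow> ('p, 'v) heap \<Rightarrow> ('p, 'v) heap set" where
  "results null (New x) H = {heap_new null q H x | q. q \<notin> pverts (gr H)}"
| "results null (Assign x y) H = {heap_assign H x y}"
| "results null (Lookup x y) H = (if lab H y \<noteq> lab H null then {heap_lookup H x y} else {})"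
| "results null (Update x y) H = (if lab H x \<noteq> lab H null then {heap_update H x y} else {})"

definition reachable_subgraph :: "('p, 'v) heap \<Rightarrow> ('v, 'v \<times> 'v) pre_digraph" where
  "reachable_subgraph H =
     with_proj (gr H) \<restriction> {v. \<exists>p. lab H p \<rightarrow>\<^sup>*\<^bsub>with_proj (gr H)\<^esub> v}"

definition heap_iso :: "('p, 'v) heap \<Rightarrow> ('p, 'w) heap \<Rightarrow> bool" (infix "\<simeq>\<^sub>H" 50) where
  "H \<simeq>\<^sub>H H' \<longleftrightarrow> (\<exists>f.
     pre_digraph.digraph_isomorphism (reachable_subgraph H) f \<and>
     reachable_subgraph H' = app_iso f (reachable_subgraph H) \<and>
     (\<forall>p. iso_verts f (lab H p) = lab H' p))"

end

theory Submission
  imports Defs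
begin

text \<open>An isomorphism of reachable sub-heaps is the same thing as an injective, label-preserving map
  \<open>g\<close> on some successor-closed set \<open>S\<close> of vertices containing all labelled ones, such that the
  successors of \<open>g u\<close> are exactly the images of the successors of \<open>u\<close>. This condition is local, so
  each transformer preserves it with the same \<open>g\<close> (extended by \<open>q \<mapsto> q'\<close> at the fresh vertices), and
  iterating it shows that \<open>g\<close> preserves and reflects paths of every length. Allowing \<open>S\<close> to be larger
  than the reachable set avoids recomputing reachability after a transformer.\<close>

definition local_iso :: "'v set \<Rightarrow> ('v \<Rightarrow> 'w) \<Rightarrow> ('p, 'v) heap \<Rightarrow> ('p, 'w) heap \<Rightarrow> bool" where
  "local_iso S g H H' \<longleftrightarrow>
     S \<subseteq> pverts (gr H) \<and> g ` S \<subseteq> pverts (gr H') \<and> inj_on g S \<and>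
     (\<forall>p. lab H p \<in> S \<and> g (lab H p) = lab H' p) \<and>
     (\<forall>u \<in> S. parcs (gr H) `` {u} \<subseteq> S \<and> parcs (gr H') `` {g u} = g ` (parcs (gr H) `` {u}))"

section \<open>Reachable vertices and the reachable sub-heap\<close>

definition reach :: "('p, 'v) heap \<Rightarrow> 'v set" where
  "reach H = {v. \<exists>p. (lab H p, v) \<in> (parcs (gr H))\<^sup>*}"

lemma is_heap_iff:
  "is_heap H \<longleftrightarrow> finite (pverts (gr H)) \<and> parcs (gr H) \<subseteq> pverts (gr H) \<times> pverts (gr H) \<and>
     range (lab H) \<subseteq> pverts (gr H)"
proof -
  have "finite (parcs (gr H))"
    if "finite (pverts (gr H))" "parcs (gr H) \<subseteq> pverts (gr H) \<times> pverts (gr H)"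
    using that by (meson finite_SigmaI finite_subset)
  then show ?thesis
    unfolding is_heap_def pair_fin_digraph_def pair_wf_digraph_def pair_fin_digraph_axioms_def
    by fastforce
qed

lemma lab_in_reach: "lab H p \<in> reach H"
  by (auto simp: reach_def)

lemma reach_closed: "u \<in> reach H \<Longrightarrow> (u, v) \<in> parcs (gr H) \<Longrightarrow> v \<in> reach H"
  by (auto simp: reach_def intro: rtrancl_into_rtrancl)

text \<open>Inclusions of \<open>reach H\<close> in another set are proved through these two local
  checks, so no path has to be handled explicitly.\<close>

lemma reach_least:
  assumes "\<And>p. lab H p \<in> S" and "\<And>u v. u \<in> S \<Longrightarrow> (u, v) \<in> parcs (gr H) \<Longrightarrow> v \<in> S"
  shows "reach H \<subseteq> S"
proof
  fix v assume "v \<in> reach H"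
  then obtain p where "(lab H p, v) \<in> (parcs (gr H))\<^sup>*" by (auto simp: reach_def)
  then show "v \<in> S" by induction (use assms in auto)
qed

lemma reach_subset_pverts: "is_heap H \<Longrightarrow> reach H \<subseteq> pverts (gr H)"
  by (rule reach_least) (auto simp: is_heap_iff)

lemma wf_digraph_heap: "is_heap H \<Longrightarrow> wf_digraph (with_proj (gr H))"
  by (simp add: wf_digraph_wp_iff is_heap_def pair_fin_digraph_def)

lemma reachable_subgraph_eq:
  assumes "is_heap H"
  shows "reachable_subgraph H = with_proj (gr H) \<restriction> reach H"
proof -
  interpret wf_digraph "with_proj (gr H)" using assms by (rule wf_digraph_heap)
  \<comment> \<open>Reachability in the graph library confines paths to vertices of the graph. This
    changes nothing here: labels are vertices, and so is everything in
    \<open>reach H\<close>.\<close>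
  have "{v. \<exists>p. lab H p \<rightarrow>\<^sup>*\<^bsub>with_proj (gr H)\<^esub> v} = reach H"
    using assms reach_subset_pverts[OF assms]
    by (auto simp: reachable_conv is_heap_iff) (auto simp: reach_def)
  then show ?thesis by (simp add: reachable_subgraph_def)
qed

lemma wf_digraph_reachable_subgraph: "is_heap H \<Longrightarrow> wf_digraph (reachable_subgraph H)"
  by (simp add: reachable_subgraph_eq reach_subset_pverts wf_digraph_heap
      wf_digraph.wellformed_induce_subgraph)

text \<open>The induced subgraph keeps the arcs with both ends in \<open>reach H\<close>. That set
  is closed under successors, so a condition on the tail alone describes the same arcs.\<close>

lemma reachable_subgraph_simps:
  assumes "is_heap H"
  shows "verts (reachable_subgraph H) = reach H"
    and "arcs (reachable_subgraph H) = {(u, v) \<in> parcs (gr H). u \<in> reach H}"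
    and "tail (reachable_subgraph H) = fst"
    and "head (reachable_subgraph H) = snd"
    and "arcs_ends (reachable_subgraph H) = {(u, v) \<in> parcs (gr H). u \<in> reach H}"
  using reach_closed[of _ H]
  by (auto simp: reachable_subgraph_eq[OF assms] arcs_ends_conv)

section \<open>Heap isomorphisms and local isomorphisms\<close>

text \<open>\<open>reach_least\<close> gives all three inclusions: \<open>S\<close>, the image of
  \<open>reach H\<close> and the preimage of \<open>reach H'\<close> each contain the labels and are
  closed under successors.\<close>

lemma reach_local_iso:
  assumes "local_iso S g H H'"
  shows "reach H \<subseteq> S" and "reach H' = g ` reach H"
proof -
  have lab: "lab H' p = g (lab H p)" "lab H p \<in> S" for p
    using assms by (simp_all add: local_iso_def)
  show S: "reach H \<subseteq> S"
    by (rule reach_least) (use assms in \<open>auto simp: local_iso_def\<close>)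
  show "reach H' = g ` reach H"
  proof
    show "reach H' \<subseteq> g ` reach H"
    proof (rule reach_least)
      show "lab H' p \<in> g ` reach H" for p
        by (simp add: lab lab_in_reach)
    next
      fix u v assume "u \<in> g ` reach H" "(u, v) \<in> parcs (gr H')"
      then obtain a where a: "a \<in> reach H" "v \<in> parcs (gr H') `` {g a}" by auto
      then have "v \<in> g ` (parcs (gr H) `` {a})"
        using assms S unfolding local_iso_def by blast
      then show "v \<in> g ` reach H" using a(1) by (auto intro: reach_closed)
    qed
    \<comment> \<open>The preimage is cut down to \<open>S\<close>, where the successor condition is
      available.\<close>
    have "reach H \<subseteq> {v \<in> S. g v \<in> reach H'}"
    proof (rule reach_least)
      show "lab H p \<in> {v \<in> S. g v \<in> reach H'}" for p
        by (simp add: lab flip: lab(1)) (simp add: lab_in_reach)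
    next
      fix u v assume "u \<in> {v \<in> S. g v \<in> reach H'}" and e: "(u, v) \<in> parcs (gr H)"
      then have u: "u \<in> S" "g u \<in> reach H'" by auto
      then have "v \<in> S" "g v \<in> parcs (gr H') `` {g u}"
        using assms e unfolding local_iso_def by blast+
      then show "v \<in> {v \<in> S. g v \<in> reach H'}"
        using u(2) by (auto intro: reach_closed)
    qed
    then show "g ` reach H \<subseteq> reach H'" by auto
  qed
qed

text \<open>Restricting \<open>g\<close> from \<open>S\<close> to \<open>reach H\<close> yields the
  isomorphism. Arcs are pairs of vertices, so \<open>map_prod g g\<close> is the arc map, and
  \<open>fst\<close> and \<open>snd\<close> still give tail and head.\<close>

lemma heap_isoI:
  assumes H: "is_heap H" and H': "is_heap H'" and iso: "local_iso S g H H'"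
  shows "H \<simeq>\<^sub>H H'"
proof -
  define f where "f = \<lparr>iso_verts = g, iso_arcs = map_prod g g, iso_head = snd, iso_tail = fst\<rparr>"
  have S: "reach H \<subseteq> S" and img: "reach H' = g ` reach H"
    using reach_local_iso[OF iso] by auto
  have inj: "inj_on g (reach H)"
    using iso S by (auto simp: local_iso_def intro: inj_on_subset)
  have step: "parcs (gr H') `` {g u} = g ` (parcs (gr H) `` {u})" if "u \<in> reach H" for u
    using iso S that unfolding local_iso_def by blast
  \<comment> \<open>Both ends of these arcs are reachable, so injectivity of \<open>g\<close> on
    vertices passes to the pairs.\<close>
  have "{(u, v) \<in> parcs (gr H). u \<in> reach H} \<subseteq> reach H \<times> reach H"
    by (auto intro: reach_closed)
  then have injA: "inj_on (map_prod g g) {(u, v) \<in> parcs (gr H). u \<in> reach H}"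
    using map_prod_inj_on[OF inj inj] inj_on_subset by blast
  have arcs: "{(u, v) \<in> parcs (gr H'). u \<in> reach H'} =
      map_prod g g ` {(u, v) \<in> parcs (gr H). u \<in> reach H}" (is "?A' = _ ` ?A")
  proof
    show "?A' \<subseteq> map_prod g g ` ?A"
    proof clarify
      fix u v assume "(u, v) \<in> parcs (gr H')" "u \<in> reach H'"
      then obtain a where a: "a \<in> reach H" "u = g a" "v \<in> parcs (gr H') `` {g a}"
        using img by auto
      then obtain b where "(a, b) \<in> parcs (gr H)" "v = g b" using step by auto
      then show "(u, v) \<in> map_prod g g ` ?A" using a by force
    qed
    show "map_prod g g ` ?A \<subseteq> ?A'" using step img by fastforce
  qed
  have "pre_digraph.digraph_isomorphism (reachable_subgraph H) f"
    using inj injA wf_digraph_reachable_subgraph[OF H]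
    by (auto simp: pre_digraph.digraph_isomorphism_def reachable_subgraph_simps[OF H] f_def)
  moreover have "reachable_subgraph H' = app_iso f (reachable_subgraph H)"
    using img arcs by (intro pre_digraph.equality)
      (auto simp: reachable_subgraph_simps[OF H] reachable_subgraph_simps[OF H'] f_def)
  moreover have "\<forall>p. iso_verts f (lab H p) = lab H' p"
    using iso by (simp add: f_def local_iso_def)
  ultimately show ?thesis unfolding heap_iso_def by blast
qed

text \<open>The vertex part of \<open>f\<close> serves as \<open>g\<close>. The arc part is seen
  only through end points: arcs of a heap are pairs, so \<open>arcs_ends\<close> recovers the arc
  set itself.\<close>

lemma heap_isoE:
  assumes H: "is_heap H" and H': "is_heap H'" and iso: "H \<simeq>\<^sub>H H'"
  obtains g where "local_iso (reach H) g H H'"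
proof -
  obtain f where f: "pre_digraph.digraph_isomorphism (reachable_subgraph H) f"
    and eq: "reachable_subgraph H' = app_iso f (reachable_subgraph H)"
    and lab: "\<And>p. iso_verts f (lab H p) = lab H' p"
    using iso by (auto simp: heap_iso_def)
  let ?g = "iso_verts f"
  interpret R: wf_digraph "reachable_subgraph H" using H by (rule wf_digraph_reachable_subgraph)
  have inj: "inj_on ?g (reach H)"
    using R.digraph_isomorphism_inj_on_verts[OF f] by (simp add: reachable_subgraph_simps[OF H])
  have img: "reach H' = ?g ` reach H"
    using arg_cong[OF eq, of verts]
    by (simp add: reachable_subgraph_simps[OF H] reachable_subgraph_simps[OF H'])
  have arcs: "{(u, v) \<in> parcs (gr H'). u \<in> reach H'} =
      (\<lambda>(u, v). (?g u, ?g v)) ` {(u, v) \<in> parcs (gr H). u \<in> reach H}" (is "?A' = ?m ` ?A")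
    using R.arcs_ends_app_iso_eq[OF f]
    unfolding eq[symmetric] reachable_subgraph_simps[OF H] reachable_subgraph_simps[OF H'] .
  have step: "parcs (gr H') `` {?g u} = ?g ` (parcs (gr H) `` {u})" if u: "u \<in> reach H" for u
  proof
    show "parcs (gr H') `` {?g u} \<subseteq> ?g ` (parcs (gr H) `` {u})"
    proof
      fix w assume "w \<in> parcs (gr H') `` {?g u}"
      then have "(?g u, w) \<in> ?A'" using u img by auto
      then have "(?g u, w) \<in> ?m ` ?A" by (simp only: arcs)
      then obtain a b where "a \<in> reach H" "(a, b) \<in> parcs (gr H)" "?g u = ?g a" "w = ?g b"
        by auto
      \<comment> \<open>Injectivity on \<open>reach H\<close> identifies \<open>a\<close> with
        \<open>u\<close>.\<close>
      then show "w \<in> ?g ` (parcs (gr H) `` {u})" using inj u by (auto dest: inj_onD)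
    qed
    have "(?g u, ?g v) \<in> ?A'" if "(u, v) \<in> parcs (gr H)" for v
      unfolding arcs using that u by force
    then show "?g ` (parcs (gr H) `` {u}) \<subseteq> parcs (gr H') `` {?g u}" by auto
  qed
  have "local_iso (reach H) ?g H H'"
    unfolding local_iso_def
    using reach_subset_pverts[OF H] reach_subset_pverts[OF H'] img inj lab step
    by (auto simp: lab_in_reach intro: reach_closed)
  then show ?thesis by (rule that)
qed

section \<open>Isomorphism as an equivalence relation\<close>

lemma heap_iso_refl: "is_heap H \<Longrightarrow> H \<simeq>\<^sub>H H"
  by (rule heap_isoI[where S = "pverts (gr H)" and g = id]) (auto simp: local_iso_def is_heap_iff)

text \<open>Successors of a vertex of \<open>S\<close> stay in \<open>S\<close>, so applying the
  inverse to their images cancels \<open>g\<close>.\<close>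

lemma local_iso_sym:
  assumes "local_iso S g H H'"
  shows "local_iso (g ` S) (the_inv_into S g) H' H"
proof -
  have inj: "inj_on g S" using assms by (simp add: local_iso_def)
  have inv: "the_inv_into S g (g u) = u" if "u \<in> S" for u
    using inj that by (rule the_inv_into_f_f)
  have lab: "lab H' p = g (lab H p)" "lab H p \<in> S" for p
    using assms by (auto simp: local_iso_def)
  have "parcs (gr H') `` {g u} \<subseteq> g ` S"
    "parcs (gr H) `` {u} = the_inv_into S g ` (parcs (gr H') `` {g u})" if u: "u \<in> S" for u
  proof -
    have cl: "parcs (gr H) `` {u} \<subseteq> S"
      and step: "parcs (gr H') `` {g u} = g ` (parcs (gr H) `` {u})"
      using assms u unfolding local_iso_def by blast+
    show "parcs (gr H') `` {g u} \<subseteq> g ` S" using cl unfolding step by (rule image_mono)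
    have "(\<lambda>v. the_inv_into S g (g v)) ` (parcs (gr H) `` {u}) = (\<lambda>v. v) ` (parcs (gr H) `` {u})"
      by (rule image_cong[OF refl]) (use cl inv in blast)
    then show "parcs (gr H) `` {u} = the_inv_into S g ` (parcs (gr H') `` {g u})"
      unfolding step image_image by simp
  qed
  moreover have "g ` S \<subseteq> pverts (gr H')" "the_inv_into S g ` g ` S \<subseteq> pverts (gr H)"
    using assms inv by (auto simp: local_iso_def)
  moreover have "lab H' p \<in> g ` S \<and> the_inv_into S g (lab H' p) = lab H p" for p
    using lab inv by simp
  ultimately show ?thesis
    using inv inj_on_the_inv_into[OF inj] unfolding local_iso_def by (simp add: ball_simps)
qed

lemma heap_iso_sym: "is_heap H \<Longrightarrow> is_heap H' \<Longrightarrow> H \<simeq>\<^sub>H H' \<Longrightarrow> H' \<simeq>\<^sub>H H"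
  by (meson heap_isoE heap_isoI local_iso_sym)

lemma heap_iso_trans:
  assumes H: "is_heap H" "is_heap H'" "is_heap H''" and iso: "H \<simeq>\<^sub>H H'" "H' \<simeq>\<^sub>H H''"
  shows "H \<simeq>\<^sub>H H''"
proof -
  obtain g where g: "local_iso (reach H) g H H'" using H(1,2) iso(1) by (rule heap_isoE)
  obtain h where h: "local_iso (reach H') h H' H''" using H(2,3) iso(2) by (rule heap_isoE)
  \<comment> \<open>The domain of \<open>h\<close> is exactly the image of the domain of
    \<open>g\<close>, so the composite satisfies every condition on all of
    \<open>reach H\<close>.\<close>
  have img: "reach H' = g ` reach H" using reach_local_iso(2)[OF g] .
  have "inj_on (h \<circ> g) (reach H)"
    using g h unfolding img by (auto simp: local_iso_def intro: comp_inj_on)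
  moreover have "parcs (gr H'') `` {h (g u)} = (h \<circ> g) ` (parcs (gr H) `` {u})"
    if "u \<in> reach H" for u
  proof -
    have "parcs (gr H'') `` {h (g u)} = h ` (parcs (gr H') `` {g u})"
      using h that img unfolding local_iso_def by blast
    also have "parcs (gr H') `` {g u} = g ` (parcs (gr H) `` {u})"
      using g that unfolding local_iso_def by blast
    finally show ?thesis by (simp add: image_comp)
  qed
  ultimately have "local_iso (reach H) (h \<circ> g) H H''"
    using g h unfolding img local_iso_def by auto
  then show ?thesis by (rule heap_isoI[OF H(1,3)])
qed

section \<open>Path lengths and circularity\<close>

text \<open>The two claims go through one induction: the successor condition may be applied to the
  vertices reached after \<open>n\<close> edges only because these lie in \<open>S\<close>.\<close>

lemma local_iso_steps:
  assumes iso: "local_iso S g H H'" and u: "u \<in> S"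
  shows "{v. steps H n u v} \<subseteq> S" and "{w. steps H' n (g u) w} = g ` {v. steps H n u v}"
proof -
  have "{v. steps H n u v} \<subseteq> S \<and> {w. steps H' n (g u) w} = g ` {v. steps H n u v}"
  proof (induction n)
    case 0
    then show ?case using u by (auto simp: steps_def)
  next
    case (Suc n)
    have H: "{v. steps H (Suc n) u v} = (\<Union>v \<in> {v. steps H n u v}. parcs (gr H) `` {v})"
      by (auto simp: steps_def)
    have "{w. steps H' (Suc n) (g u) w} = (\<Union>w \<in> {w. steps H' n (g u) w}. parcs (gr H') `` {w})"
      by (auto simp: steps_def)
    also have "\<dots> = (\<Union>v \<in> {v. steps H n u v}. parcs (gr H') `` {g v})"
      using Suc by auto
    also have "\<dots> = (\<Union>v \<in> {v. steps H n u v}. g ` (parcs (gr H) `` {v}))"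
      by (rule SUP_cong[OF refl]) (use Suc iso in \<open>unfold local_iso_def, blast\<close>)
    also have "\<dots> = g ` {v. steps H (Suc n) u v}" unfolding H by blast
    finally have "{w. steps H' (Suc n) (g u) w} = g ` {v. steps H (Suc n) u v}" .
    moreover have "{v. steps H (Suc n) u v} \<subseteq> S"
      unfolding H using Suc iso unfolding local_iso_def by blast
    ultimately show ?case by blast
  qed
  then show "{v. steps H n u v} \<subseteq> S" "{w. steps H' n (g u) w} = g ` {v. steps H n u v}" by auto
qed

text \<open>Injectivity turns the image equation into an equivalence: \<open>g v\<close> cannot be
  the image of another vertex of \<open>S\<close>.\<close>

lemma local_iso_steps_iff:
  assumes iso: "local_iso S g H H'" and u: "u \<in> S" and v: "v \<in> S"
  shows "steps H' n (g u) (g v) \<longleftrightarrow> steps H n u v"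
proof -
  have inj: "inj_on g S" using iso by (simp add: local_iso_def)
  have "steps H' n (g u) (g v) \<longleftrightarrow> g v \<in> g ` {v. steps H n u v}"
    using local_iso_steps(2)[OF iso u, of n] by auto
  also have "\<dots> \<longleftrightarrow> v \<in> {v. steps H n u v}"
    using inj v local_iso_steps(1)[OF iso u] by (rule inj_on_image_mem_iff)
  finally show ?thesis by simp
qed

lemma local_iso_path_length:
  assumes "local_iso S g H H'"
  shows "path_length H x y = path_length H' x y"
proof -
  have "lab H' p = g (lab H p)" "lab H p \<in> S" for p
    using assms by (auto simp: local_iso_def)
  then show ?thesis
    unfolding path_length_def using local_iso_steps_iff[OF assms] by simp
qed

text \<open>One implication is enough, as \<open>local_iso_sym\<close> supplies the converse. The
  vertex \<open>v\<close> on the cycle lies in \<open>S\<close> because paths from a label never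
  leave \<open>S\<close>.\<close>

lemma local_iso_circular:
  assumes iso: "local_iso S g H H'" and "circular H x"
  shows "circular H' x"
proof -
  obtain v n m where nm: "n > 0" "m > 0"
    and v: "steps H n (lab H x) v" "steps H m v (lab H x)"
    using assms(2) by (auto simp: circular_def)
  have x: "lab H x \<in> S" "lab H' x = g (lab H x)" using iso by (auto simp: local_iso_def)
  have vS: "v \<in> S" using local_iso_steps(1)[OF iso x(1)] v(1) by blast
  then have "g v \<in> pverts (gr H')" using iso by (auto simp: local_iso_def)
  moreover have "steps H' n (lab H' x) (g v)" "steps H' m (g v) (lab H' x)"
    using local_iso_steps_iff[OF iso] x v vS by simp_all
  ultimately show ?thesis using nm by (auto simp: circular_def)
qed

section \<open>Successors and the effect of the transformers\<close>

text \<open>Outdegree 1 leaves a single arc at \<open>v\<close>, and its second component is the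
  successor; this justifies the definite description in \<open>succ\<close>.\<close>

lemma singly_linked_succ:
  assumes H: "singly_linked null H" and v: "v \<in> pverts (gr H)" "v \<noteq> lab H null"
  shows "parcs (gr H) `` {v} = {succ H v}"
proof -
  have "out_degree (with_proj (gr H)) v = 1"
    using H v by (auto simp: singly_linked_def)
  then obtain e where e: "out_arcs (with_proj (gr H)) v = {e}"
    by (auto simp: out_degree_def card_1_singleton_iff)
  have "parcs (gr H) `` {v} = snd ` out_arcs (with_proj (gr H)) v"
    by (force simp: out_arcs_def)
  then have w: "parcs (gr H) `` {v} = {snd e}" by (simp add: e)
  then have "succ H v = snd e" unfolding succ_def by (intro the_equality) auto
  then show ?thesis using w by simp
qed

text \<open>Supplies the heap conditions of \<open>heap_isoI\<close>. The result may fail to be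
  singly linked, for instance when \<open>null\<close> itself is assigned a vertex with an outgoing
  edge.\<close>

lemma is_heap_results:
  assumes H: "singly_linked null H" and K: "K \<in> results null \<tau> H"
  shows "is_heap K"
proof -
  have h: "is_heap H" using H by (simp add: singly_linked_def)
  \<comment> \<open>For \<open>Lookup\<close>, the new label has to be a vertex.\<close>
  have s: "succ H (lab H y) \<in> pverts (gr H)" if "lab H y \<noteq> lab H null" for y
    using singly_linked_succ[OF H _ that] h by (auto simp: is_heap_iff)
  show ?thesis
  proof (cases \<tau>)
    case (New x)
    have "parcs (gr H) \<subseteq> pverts (gr H) \<times> pverts (gr H)" "lab H p \<in> pverts (gr H)" for p
      using h by (auto simp: is_heap_iff)
    then show ?thesis using h K New by (auto simp: is_heap_iff heap_new_def)
  next
    case (Assign x y)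
    then show ?thesis using h K by (auto simp: is_heap_iff heap_assign_def)
  next
    case (Lookup x y)
    then show ?thesis using h K s by (auto simp: is_heap_iff heap_lookup_def split: if_splits)
  next
    case (Update x y)
    then show ?thesis using h K by (auto simp: is_heap_iff heap_update_def split: if_splits)
  qed
qed

text \<open>The fresh vertices may differ, and mapping \<open>q\<close> to \<open>q'\<close> stays
  injective since \<open>q'\<close> is outside the image of \<open>S\<close>. Their only successors
  are the \<open>null\<close> labels, which correspond under \<open>g\<close>.\<close>

lemma local_iso_new:
  assumes H: "is_heap H" "is_heap H'" and iso: "local_iso S g H H'"
    and q: "q \<notin> pverts (gr H)" "q' \<notin> pverts (gr H')"
  shows "local_iso (insert q S) (g(q := q')) (heap_new null q H x) (heap_new null q' H' x)"
proof -
  let ?E = "parcs (gr (heap_new null q H x))" and ?E' = "parcs (gr (heap_new null q' H' x))"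
  have qS: "q \<notin> S" "q' \<notin> g ` S" using iso q by (auto simp: local_iso_def)
  have lab: "lab H p \<in> S" "g (lab H p) = lab H' p" for p using iso by (auto simp: local_iso_def)
  have img: "(g(q := q')) ` A = g ` A" if "A \<subseteq> S" for A
    using that qS by (auto simp: image_iff)
  \<comment> \<open>Old arcs run between old vertices, so the added edge is the only one leaving
    \<open>q\<close>.\<close>
  have E: "?E `` {u} = (if u = q then {lab H null} else parcs (gr H) `` {u})" for u
    using H(1) q(1) by (auto simp: heap_new_def is_heap_iff)
  have E': "?E' `` {u} = (if u = q' then {lab H' null} else parcs (gr H') `` {u})" for u
    using H(2) q(2) by (auto simp: heap_new_def is_heap_iff)
  have "?E `` {u} \<subseteq> insert q S \<and> ?E' `` {(g(q := q')) u} = (g(q := q')) ` (?E `` {u})"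
    if u: "u \<in> insert q S" for u
  proof (cases "u = q")
    case True
    then show ?thesis using lab[of null] qS(1) by (auto simp: E E')
  next
    case False
    then have uS: "u \<in> S" using u by simp
    then have "g u \<noteq> q'" using qS(2) by auto
    moreover have cl: "parcs (gr H) `` {u} \<subseteq> S"
      and "parcs (gr H') `` {g u} = g ` (parcs (gr H) `` {u})"
      using iso uS unfolding local_iso_def by blast+
    ultimately show ?thesis using False img[OF cl] unfolding E E' by auto
  qed
  moreover have "inj_on (g(q := q')) (insert q S)"
    using iso qS by (auto simp: local_iso_def inj_on_def)
  moreover have "insert q S \<subseteq> pverts (gr (heap_new null q H x))"
    "(g(q := q')) ` insert q S \<subseteq> pverts (gr (heap_new null q' H' x))"
    using iso by (auto simp: local_iso_def heap_new_def)
  moreover have "lab (heap_new null q H x) p \<in> insert q S \<and>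
      (g(q := q')) (lab (heap_new null q H x) p) = lab (heap_new null q' H' x) p" for p
    using lab[of p] qS by (auto simp: heap_new_def)
  ultimately show ?thesis unfolding local_iso_def by blast
qed

text \<open>Covers both \<open>heap_assign\<close> and \<open>heap_lookup\<close>. The graph is
  untouched, and \<open>S\<close> need not shrink when vertices become unreachable.\<close>

lemma local_iso_relabel:
  assumes "local_iso S g H H'" and "v \<in> S"
  shows "local_iso S g (H\<lparr>lab := (lab H)(x := v)\<rparr>) (H'\<lparr>lab := (lab H')(x := g v)\<rparr>)"
  using assms by (simp add: local_iso_def)

text \<open>By injectivity \<open>g v\<close> is not the \<open>null\<close> vertex of
  \<open>H'\<close>. Hence both successor sets are singletons, and the successor condition equates
  their elements.\<close>

lemma local_iso_succ:
  assumes H: "singly_linked null H" "singly_linked null H'" and iso: "local_iso S g H H'"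
    and v: "v \<in> S" "v \<noteq> lab H null"
  shows "succ H v \<in> S" and "succ H' (g v) = g (succ H v)"
proof -
  have "lab H null \<in> S" "g (lab H null) = lab H' null" "inj_on g S"
    using iso by (auto simp: local_iso_def)
  then have "g v \<noteq> lab H' null" using v by (metis inj_onD)
  moreover have "g v \<in> pverts (gr H')" "v \<in> pverts (gr H)"
    using iso v(1) by (auto simp: local_iso_def)
  ultimately have eq: "parcs (gr H) `` {v} = {succ H v}" "parcs (gr H') `` {g v} = {succ H' (g v)}"
    using singly_linked_succ[OF H(1) _ v(2)] singly_linked_succ[OF H(2)] by auto
  have cl: "parcs (gr H) `` {v} \<subseteq> S"
    and "parcs (gr H') `` {g v} = g ` (parcs (gr H) `` {v})"
    using iso v(1) unfolding local_iso_def by blast+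
  then show "succ H v \<in> S" "succ H' (g v) = g (succ H v)" unfolding eq by auto
qed

text \<open>The removed edge was the only one leaving \<open>lab H x\<close>. Inserting after the
  removal also covers the case where \<open>lab H y\<close> is the old successor.\<close>

lemma update_successors:
  assumes H: "singly_linked null H" and x: "lab H x \<noteq> lab H null"
  shows "parcs (gr (heap_update H x y)) `` {u} =
    (if u = lab H x then {lab H y} else parcs (gr H) `` {u})"
proof -
  have "lab H x \<in> pverts (gr H)" using H by (auto simp: singly_linked_def is_heap_iff)
  then have "parcs (gr H) `` {lab H x} = {succ H (lab H x)}"
    using singly_linked_succ[OF H _ x] by simp
  then show ?thesis by (auto simp: heap_update_def)
qed

text \<open>Successors change only at the vertices labelled \<open>x\<close>, which injectivity
  matches exactly; the new ones are the \<open>y\<close> labels, which lie in \<open>S\<close> and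
  its image.\<close>

lemma local_iso_update:
  assumes H: "singly_linked null H" "singly_linked null H'" and iso: "local_iso S g H H'"
    and x: "lab H x \<noteq> lab H null" "lab H' x \<noteq> lab H' null"
  shows "local_iso S g (heap_update H x y) (heap_update H' x y)"
proof -
  have lab: "lab H p \<in> S" "g (lab H p) = lab H' p" for p using iso by (auto simp: local_iso_def)
  have inj: "inj_on g S" using iso by (simp add: local_iso_def)
  have "g u = lab H' x \<longleftrightarrow> u = lab H x" if "u \<in> S" for u
    using that lab[of x] inj by (metis inj_onD)
  moreover have "parcs (gr H) `` {u} \<subseteq> S \<and> parcs (gr H') `` {g u} = g ` (parcs (gr H) `` {u})"
    if "u \<in> S" for u
    using iso that unfolding local_iso_def by blast
  ultimately have "parcs (gr (heap_update H x y)) `` {u} \<subseteq> S \<and>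
      parcs (gr (heap_update H' x y)) `` {g u} = g ` (parcs (gr (heap_update H x y)) `` {u})"
    if "u \<in> S" for u
    using that lab[of y] unfolding update_successors[OF H(1) x(1)] update_successors[OF H(2) x(2)]
    by simp
  moreover have "pverts (gr (heap_update H x y)) = pverts (gr H)" "lab (heap_update H x y) = lab H"
    by (simp_all add: heap_update_def)
  moreover have "pverts (gr (heap_update H' x y)) = pverts (gr H')"
      "lab (heap_update H' x y) = lab H'"
    by (simp_all add: heap_update_def)
  ultimately show ?thesis using iso by (simp add: local_iso_def)
qed

section \<open>Definedness and isomorphism of the results\<close>

lemma local_iso_lab_eq_iff:
  assumes "local_iso S g H H'"
  shows "lab H' x = lab H' y \<longleftrightarrow> lab H x = lab H y"
  using assms unfolding local_iso_def by (metis inj_onD)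

text \<open>A fresh vertex always exists, as heaps are finite and the vertex types infinite. The
  guards of \<open>Lookup\<close> and \<open>Update\<close> compare labels, so they agree on both
  sides.\<close>

lemma results_empty_iff:
  fixes H :: "('p, 'v :: infinite) heap" and H' :: "('p, 'w :: infinite) heap"
  assumes "is_heap H" "is_heap H'" and "local_iso S g H H'"
  shows "results null \<tau> H = {} \<longleftrightarrow> results null \<tau> H' = {}"
proof (cases \<tau>)
  case (New x)
  have "\<exists>q. q \<notin> pverts (gr H)" "\<exists>q. q \<notin> pverts (gr H')"
    using assms(1,2) ex_new_if_finite[OF infinite_UNIV] by (auto simp: is_heap_iff)
  then show ?thesis using New by auto
qed (use local_iso_lab_eq_iff[OF assms(3)] in auto)

lemma heap_iso_results:
  assumes H: "singly_linked null H" "singly_linked null H'" and iso: "local_iso S g H H'"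
    and K: "K \<in> results null \<tau> H" "K' \<in> results null \<tau> H'"
  shows "K \<simeq>\<^sub>H K'"
proof -
  have h: "is_heap H" "is_heap H'" using H by (auto simp: singly_linked_def)
  have lab: "lab H p \<in> S" "g (lab H p) = lab H' p" for p using iso by (auto simp: local_iso_def)
  \<comment> \<open>\<open>S\<close> and \<open>g\<close> are quantified afresh because
    \<open>New\<close> enlarges both, depending on the independently chosen \<open>q\<close> and
    \<open>q'\<close>.\<close>
  have "\<exists>S g. local_iso S g K K'"
  proof (cases \<tau>)
    case (New x)
    then obtain q q' where "q \<notin> pverts (gr H)" "K = heap_new null q H x"
      "q' \<notin> pverts (gr H')" "K' = heap_new null q' H' x"
      using K by auto
    then show ?thesis using local_iso_new[OF h iso] by blast
  next
    case (Assign x y)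
    then show ?thesis
      using K local_iso_relabel[OF iso lab(1)[of y], of x] lab(2)[of y]
      by (auto simp: heap_assign_def)
  next
    case (Lookup x y)
    then have y: "lab H y \<noteq> lab H null" and eq: "K = heap_lookup H x y" "K' = heap_lookup H' x y"
      using K by (auto split: if_splits)
    have "local_iso S g K K'"
      using local_iso_relabel[OF iso local_iso_succ(1)[OF H iso lab(1) y], of x]
        local_iso_succ(2)[OF H iso lab(1) y]
      by (simp add: eq heap_lookup_def lab(2))
    then show ?thesis by blast
  next
    case (Update x y)
    then show ?thesis using K local_iso_update[OF H iso] by (auto split: if_splits)
  qed
  then show ?thesis
    using heap_isoI is_heap_results[OF H(1) K(1)] is_heap_results[OF H(2) K(2)] by blast
qed

theorem theorem1:
  fixes null :: "'p :: finite"
  shows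
    "equiv {H :: ('p, 'v :: infinite) heap. singly_linked null H}
       {(H, H'). singly_linked null H \<and> singly_linked null H' \<and> H \<simeq>\<^sub>H H'} \<and>
     (\<forall>(H :: ('p, 'v) heap) (H' :: ('p, 'v) heap).
        singly_linked null H \<longrightarrow> singly_linked null H' \<longrightarrow> H \<simeq>\<^sub>H H' \<longrightarrow>
          (\<forall>x y. path_length H x y = path_length H' x y) \<and>
          (\<forall>x. circular H x \<longleftrightarrow> circular H' x) \<and>
          (\<forall>\<tau>. (results null \<tau> H = {} \<longleftrightarrow> results null \<tau> H' = {}) \<and>
               (\<forall>K \<in> results null \<tau> H. \<forall>K' \<in> results null \<tau> H'. K \<simeq>\<^sub>H K')))"
proof (intro conjI allI impI)
  have heap: "is_heap H" if "singly_linked null H" for H :: "('p, 'v) heap"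
    using that by (simp add: singly_linked_def)
  show "equiv {H :: ('p, 'v) heap. singly_linked null H}
       {(H, H'). singly_linked null H \<and> singly_linked null H' \<and> H \<simeq>\<^sub>H H'}"
  proof (rule equivI)
    show "refl_on {H :: ('p, 'v) heap. singly_linked null H}
        {(H, H'). singly_linked null H \<and> singly_linked null H' \<and> H \<simeq>\<^sub>H H'}"
      by (auto simp: refl_on_def intro: heap_iso_refl heap)
    show "sym {(H :: ('p, 'v) heap, H'). singly_linked null H \<and> singly_linked null H' \<and> H \<simeq>\<^sub>H H'}"
      by (auto simp: sym_def intro: heap_iso_sym heap)
    show "trans {(H :: ('p, 'v) heap, H'). singly_linked null H \<and> singly_linked null H' \<and> H \<simeq>\<^sub>H H'}"
      by (auto simp: trans_def intro: heap_iso_trans heap)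
  qed auto
  fix H H' :: "('p, 'v) heap"
  assume H: "singly_linked null H" "singly_linked null H'" and "H \<simeq>\<^sub>H H'"
  then obtain g where iso: "local_iso (reach H) g H H'" by (meson heap heap_isoE)
  show "path_length H x y = path_length H' x y" for x y
    using iso by (rule local_iso_path_length)
  show "circular H x \<longleftrightarrow> circular H' x" for x
    using local_iso_circular[OF iso] local_iso_circular[OF local_iso_sym[OF iso]] by blast
  fix \<tau>
  show "results null \<tau> H = {} \<longleftrightarrow> results null \<tau> H' = {}"
    using heap[OF H(1)] heap[OF H(2)] iso by (rule results_empty_iff)
  show "\<forall>K \<in> results null \<tau> H. \<forall>K' \<in> results null \<tau> H'. K \<simeq>\<^sub>H K'"
    using heap_iso_results[OF H iso] by blast
qed

end
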